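(* Let $C,E:\aleph\to\mathbb{R}_{>0}$ be functions with the following properties. (P1) There is a continuous function $\omega_1:\mathbb{R}_{>0}\to\mathbb{R}_{>0}$ with $\lim_{s\to0}\omega_1(s)=0$ and $E(\boldsymbol\delta)\le\omega_1(\|\boldsymbol\rho\|_\infty)$ for all $n\ge1$ and $\boldsymbol\delta=(\boldsymbol h,\boldsymbol t,\boldsymbol\rho)\in\aleph_n$. (P2) There is a strictly increasing continuous function $\omega_2:[0,\infty)\to[0,\infty)$ with $\omega_2(0)=0$ and $\Delta E(\boldsymbol\delta;j)\le-\omega_2(\rho_j)$ for all $n\ge1$, $\boldsymbol\delta\in\aleph_n$ and $j\in\{0,\ldots,n\}$. (P3) $\Delta C(\boldsymbol\delta;\arg\min_i\rho_i)>0$ for all $n\ge1$ and $\boldsymbol\delta\in\aleph_n$. (P4) There is a continuous function $\omega_4:\mathbb{R}_{>0}\to\mathbb{R}_{>0}$ such that $\Delta C(\boldsymbol\delta;j)\le\omega_4(\rho_j)\,\Delta C(\boldsymbol\delta;\arg\min_i\rho_i)$ for all $n\ge1$, $\boldsymbol\delta\in\aleph_n$ and $j\in\{0,\ldots,n\}$. Then for any $\boldsymbol\delta^{(0)}\in\aleph_{n_0}$ (with $n_0\ge1$) and any $\varepsilon>0$, the Refinement Algorithm (defined in the context) terminates after a finite number $m$ of iterations and returns a $\boldsymbol\delta^{(m)}\in\aleph_{n_m}$ with $E(\boldsymbol\delta^{(m)})\le\varepsilon$.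
   Context: Constants $L,P,T>0$ are fixed; $\|\cdot\|_\infty$ is the max norm. For $n\ge1$, $\aleph_n$ is the set of all $\boldsymbol\delta=(\boldsymbol h,\boldsymbol t,\boldsymbol\rho)$ with $\boldsymbol h=(h_1,\ldots,h_n)\in\mathbb{R}^n_{>0}$, $\boldsymbol t=(t_0,\ldots,t_n)$, $\boldsymbol\rho=(\rho_0,\ldots,\rho_n)\in\mathbb{R}^{n+1}_{>0}$ such that $t_k=\sum_{j=1}^kh_j$ for $0\le k\le n$, $t_n=T$, $\|\boldsymbol h\|_\infty\le\frac1{4L}$, $\|\boldsymbol\rho\|_\infty\le\frac P{8L}$, $\rho_j/\rho_k\in\{4^\ell:\ell\in\mathbb{Z}\}$ for all $j,k\in\{0,\ldots,n\}$, and $\rho_j=2LPh_j^2$ for all $j\in\{1,\ldots,n\}$. $\aleph:=\bigcup_{n\ge1}\aleph_n$. Subdivision rule: for $\boldsymbol\delta\in\aleph_n$ and $j\in\{0,\ldots,n\}$, $\psi[\boldsymbol\delta;j]$ is defined as follows. $\psi[\boldsymbol\delta;0]:=(\boldsymbol h,\boldsymbol t,(\rho_0/4,\rho_1,\ldots,\rho_n))$. For $j\in\{1,\ldots,n\}$, $\psi[\boldsymbol\delta;j]$ has components $(h_1,\ldots,h_{j-1},h_j/2,h_j/2,h_{j+1},\ldots,h_n)$, $(t_0,\ldots,t_{j-1},t_j-h_j/2,t_j,t_{j+1},\ldots,t_n)$, $(\rho_0,\ldots,\rho_{j-1},\rho_j/4,\rho_j/4,\rho_{j+1},\ldots,\rho_n)$.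 $\Delta C(\boldsymbol\delta;j):=C(\psi[\boldsymbol\delta;j])-C(\boldsymbol\delta)$ and $\Delta E(\boldsymbol\delta;j):=E(\psi[\boldsymbol\delta;j])-E(\boldsymbol\delta)$. Convention: $\arg\min$ denotes any index attaining the minimum; (P3) and (P4) are required for every index $k$ with $\rho_k=\min_i\rho_i$. Refinement Algorithm (input $\varepsilon>0$, $\boldsymbol\delta^{(0)}\in\aleph_{n_0}$, $C$, $E$): set $m=0$. While $E(\boldsymbol\delta^{(m)})>\varepsilon$: if $\min_{j\in\{0,\ldots,n_m\}}\Delta C(\boldsymbol\delta^{(m)};j)>0$, let $k_m$ be a minimizer over $j\in\{0,\ldots,n_m\}$ of $\Delta E(\boldsymbol\delta^{(m)};j)/\Delta C(\boldsymbol\delta^{(m)};j)$; otherwise let $k_m$ be a minimizer over $j\in\{0,\ldots,n_m\}$ of $\Delta C(\boldsymbol\delta^{(m)};j)$. Set $\boldsymbol\delta^{(m+1)}=\psi[\boldsymbol\delta^{(m)};k_m]$; set $n_{m+1}=n_m+1$ if $k_m>0$ and $n_{m+1}=n_m$ if $k_m=0$; increase $m$ by 1. Return $n_m$ and $\boldsymbol\delta^{(m)}$. *)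

theory Defs
  imports Complex_Main
begin

text \<open>
  A discretisation is a triple \<open>(h, t, \<rho>)\<close> of lists.  The list \<open>h\<close> of length \<open>n\<close> holds
  \<open>h\<^sub>1, \<dots>, h\<^sub>n\<close>, so \<open>h\<^sub>j\<close> is \<open>h ! (j - 1)\<close>; the lists \<open>t\<close> and \<open>\<rho>\<close> of length \<open>n + 1\<close>
  are indexed from \<open>0\<close>, so \<open>t\<^sub>j\<close> is \<open>t ! j\<close> and \<open>\<rho>\<^sub>j\<close> is \<open>\<rho> ! j\<close>.
\<close>

type_synonym discretisation = "real list \<times> real list \<times> real list"

text \<open>Only meaningful for nonempty lists.\<close>

definition max_norm :: "real list \<Rightarrow> real" where
  "max_norm xs = Max (abs ` set xs)"

definition aleph_n :: "real \<Rightarrow> real \<Rightarrow> real \<Rightarrow> nat \<Rightarrow> discretisation set" where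
  "aleph_n L P T n = {(h, t, \<rho>).
     length h = n \<and> length t = n + 1 \<and> length \<rho> = n + 1 \<and>
     (\<forall>x\<in>set h. x > 0) \<and> (\<forall>x\<in>set \<rho>. x > 0) \<and>
     (\<forall>k\<in>{0..n}. t ! k = (\<Sum>j=1..k. h ! (j - 1))) \<and>
     t ! n = T \<and>
     max_norm h \<le> 1 / (4 * L) \<and>
     max_norm \<rho> \<le> P / (8 * L) \<and>
     (\<forall>j\<in>{0..n}. \<forall>k\<in>{0..n}. \<rho> ! j / \<rho> ! k \<in> {4 powi l | l :: int. True}) \<and>
     (\<forall>j\<in>{1..n}. \<rho> ! j = 2 * L * P * (h ! (j - 1))\<^sup>2)}"

definition aleph :: "real \<Rightarrow> real \<Rightarrow> real \<Rightarrow> discretisation set" where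
  "aleph L P T = (\<Union>n\<in>{1..}. aleph_n L P T n)"

fun subdivide :: "discretisation \<Rightarrow> nat \<Rightarrow> discretisation" where
  "subdivide (h, t, \<rho>) j =
     (if j = 0 then (h, t, \<rho>[0 := \<rho> ! 0 / 4])
      else (take (j - 1) h @ [h ! (j - 1) / 2, h ! (j - 1) / 2] @ drop j h,
            take j t @ [t ! j - h ! (j - 1) / 2] @ drop j t,
            take j \<rho> @ [\<rho> ! j / 4, \<rho> ! j / 4] @ drop (j + 1) \<rho>))"

definition increment :: "(discretisation \<Rightarrow> real) \<Rightarrow> discretisation \<Rightarrow> nat \<Rightarrow> real" where
  "increment F \<delta> j = F (subdivide \<delta> j) - F \<delta>"

text \<open>
  The index \<open>k\<close> may be chosen by the algorithm.  Any index attaining the relevant minimum is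
  admissible, so the algorithm is nondeterministic.
\<close>

definition admissible_index ::
  "(discretisation \<Rightarrow> real) \<Rightarrow> (discretisation \<Rightarrow> real) \<Rightarrow> nat \<Rightarrow> discretisation \<Rightarrow> nat \<Rightarrow> bool" where
  "admissible_index C E n \<delta> k \<longleftrightarrow>
     (if Min (increment C \<delta> ` {0..n}) > 0
      then is_arg_min (\<lambda>j. increment E \<delta> j / increment C \<delta> j) (\<lambda>j. j \<in> {0..n}) k
      else is_arg_min (increment C \<delta>) (\<lambda>j. j \<in> {0..n}) k)"

text \<open>
  One pass through the body of the while loop, including the test of its guard, as a relation
  between program states \<open>(n\<^sub>m, \<delta>\<^sup>(\<^sup>m\<^sup>))\<close>.
\<close>

definition iteration ::
  "(discretisation \<Rightarrow> real) \<Rightarrow> (discretisation \<Rightarrow> real) \<Rightarrow> real \<Rightarrow>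
   nat \<times> discretisation \<Rightarrow> nat \<times> discretisation \<Rightarrow> bool" where
  "iteration C E \<epsilon> = (\<lambda>(n, \<delta>) (n', \<delta>').
     E \<delta> > \<epsilon> \<and>
     (\<exists>k. admissible_index C E n \<delta> k \<and>
          \<delta>' = subdivide \<delta> k \<and> n' = (if k > 0 then n + 1 else n)))"

text \<open>Started in \<open>s\<close>, some execution leaves the loop after \<open>m\<close> iterations, returning \<open>(n, \<delta>)\<close>.\<close>

definition algorithm_returns ::
  "(discretisation \<Rightarrow> real) \<Rightarrow> (discretisation \<Rightarrow> real) \<Rightarrow> real \<Rightarrow>
   nat \<times> discretisation \<Rightarrow> nat \<Rightarrow> nat \<times> discretisation \<Rightarrow> bool" where
  "algorithm_returns C E \<epsilon> s m = (\<lambda>(n, \<delta>).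
     (iteration C E \<epsilon> ^^ m) s (n, \<delta>) \<and> \<not> E \<delta> > \<epsilon>)"

text \<open>
  Started in \<open>s\<close>, every execution leaves the loop after finitely many iterations, whichever
  minimisers are chosen: no execution runs forever, and none gets stuck inside the loop
  for want of an admissible index.
\<close>

definition algorithm_terminates ::
  "(discretisation \<Rightarrow> real) \<Rightarrow> (discretisation \<Rightarrow> real) \<Rightarrow> real \<Rightarrow> nat \<times> discretisation \<Rightarrow> bool" where
  "algorithm_terminates C E \<epsilon> s \<longleftrightarrow>
     \<not> (\<exists>\<sigma> :: nat \<Rightarrow> nat \<times> discretisation.
          \<sigma> 0 = s \<and> (\<forall>m. iteration C E \<epsilon> (\<sigma> m) (\<sigma> (Suc m)))) \<and>
     (\<forall>m n \<delta>. (iteration C E \<epsilon> ^^ m) s (n, \<delta>) \<longrightarrow> E \<delta> > \<epsilon> \<longrightarrow>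
        (\<exists>s'. iteration C E \<epsilon> (n, \<delta>) s'))"

end

theory Submission imports Defs begin

text \<open>
  Suppose an execution runs forever.  Then \<open>E\<close> decreases and stays positive, so its decrements
  tend to \<open>0\<close>, while by (P1) some \<open>\<rho>\<^sub>j\<close> stays above a threshold \<open>s > 0\<close>.  An index minimising
  \<open>\<rho>\<close> has \<open>\<Delta>C > 0\<close> by (P3), so it can only be selected through the quotient \<open>\<Delta>E / \<Delta>C\<close>;
  comparison with \<open>j\<close>, using (P2) and (P4), shows that such a step decreases \<open>E\<close> by at least a
  fixed amount, so eventually no minimising index is selected.  Since the \<open>\<rho>\<^sub>i\<close> differ by powers
  of \<open>4\<close>, selecting any other index does not lower \<open>min \<rho>\<close>.  Hence the selected \<open>\<rho>\<^sub>k\<close> stay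
  bounded below, and by (P2) so do the decrements of \<open>E\<close>, a contradiction.
\<close>

section \<open>The max norm, and \<open>aleph_n\<close> in terms of list operations\<close>

lemma max_norm_le_iff:
  assumes "xs \<noteq> []"
  shows "max_norm xs \<le> B \<longleftrightarrow> (\<forall>x\<in>set xs. \<bar>x\<bar> \<le> B)"
  using assms by (simp add: max_norm_def)

lemma max_norm_mem:
  assumes "xs \<noteq> []" and "\<forall>x\<in>set xs. 0 < x"
  shows "max_norm xs \<in> set xs"
proof -
  have "abs ` set xs = set xs"
    using assms(2) by force
  then show ?thesis
    using assms(1) Max_in[of "set xs"] by (simp add: max_norm_def)
qed

lemma all_nth_iff_set:
  assumes "length xs = n + 1"
  shows "(\<forall>j\<in>{0..n}. Q (xs ! j)) \<longleftrightarrow> (\<forall>x\<in>set xs. Q x)"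
  using assms by (auto simp: all_set_conv_all_nth less_Suc_eq_le)

text \<open>Trades indices for lists, so that subdividing becomes list surgery: bounds and ratios
  become conditions on sets of entries, and the coupling of \<rho> with \<open>h\<close> makes the
  tail of \<rho> a \<open>map\<close>, leaving the head \<open>r\<close> as its only free entry.
  With \<open>n \<ge> 1\<close> the list \<open>h\<close> is nonempty and \<open>max_norm h\<close>
  a genuine maximum.\<close>

lemma aleph_n_iff:
  assumes "n \<ge> 1"
  shows "(h, t, \<rho>) \<in> aleph_n L P T n \<longleftrightarrow>
    length h = n \<and> length t = n + 1 \<and>
    (\<forall>k\<le>n. t ! k = sum_list (take k h)) \<and> t ! n = T \<and>
    (\<forall>x\<in>set h. 0 < x \<and> x \<le> 1 / (4 * L)) \<and> (\<forall>x\<in>set \<rho>. 0 < x \<and> x \<le> P / (8 * L)) \<and>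
    (\<forall>x\<in>set \<rho>. \<forall>y\<in>set \<rho>. \<exists>l::int. x / y = 4 powi l) \<and>
    (\<exists>r. \<rho> = r # map (\<lambda>x. 2 * L * P * x\<^sup>2) h)" (is "?A \<longleftrightarrow> ?B")
proof -
  have sums: "(\<Sum>j=1..k. h ! (j - 1)) = sum_list (take k h)" if "length h = n" "k \<le> n" for k
  proof -
    have "(\<Sum>j=1..k. h ! (j - 1)) = (\<Sum>i<k. h ! i)"
      by (rule sum.reindex_bij_witness[of _ Suc "\<lambda>j. j - 1"]) auto
    also have "\<dots> = sum_list (take k h)"
      using that by (auto simp: sum_list_sum_nth atLeast0LessThan intro!: sum.cong)
    finally show ?thesis .
  qed
  have norms: "(\<forall>x\<in>set xs. 0 < x) \<and> max_norm xs \<le> B \<longleftrightarrow> (\<forall>x\<in>set xs. 0 < x \<and> x \<le> B)"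
    if "xs \<noteq> []" for xs B
    using max_norm_le_iff[OF that] by fastforce
  \<comment> \<open>The two index quantifiers are converted one at a time, the inner one first; the
    patterns given for \<open>Q\<close> select which.\<close>
  have ratios: "(\<forall>j\<in>{0..n}. \<forall>k\<in>{0..n}. \<rho> ! j / \<rho> ! k \<in> {4 powi l | l :: int. True}) \<longleftrightarrow>
      (\<forall>x\<in>set \<rho>. \<forall>y\<in>set \<rho>. \<exists>l::int. x / y = 4 powi l)" if "length \<rho> = n + 1"
    unfolding all_nth_iff_set[OF that, where Q = "\<lambda>y. _ / y \<in> _"]
      all_nth_iff_set[OF that, where Q = "\<lambda>x. \<forall>y\<in>_. x / y \<in> _"] by blast
  have coupling: "length \<rho> = n + 1 \<and> (\<forall>j\<in>{1..n}. \<rho> ! j = 2 * L * P * (h ! (j - 1))\<^sup>2) \<longleftrightarrow>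
      (\<exists>r. \<rho> = r # map (\<lambda>x. 2 * L * P * x\<^sup>2) h)" if "length h = n"
  proof
    assume *: "length \<rho> = n + 1 \<and> (\<forall>j\<in>{1..n}. \<rho> ! j = 2 * L * P * (h ! (j - 1))\<^sup>2)"
    then obtain r \<rho>' where \<rho>: "\<rho> = r # \<rho>'"
      by (cases \<rho>) auto
    have "\<rho>' ! i = 2 * L * P * (h ! i)\<^sup>2" if "i < n" for i
      using *[THEN conjunct2, rule_format, of "Suc i"] that by (simp add: \<rho>)
    then have "\<rho>' = map (\<lambda>x. 2 * L * P * x\<^sup>2) h"
      using * \<open>length h = n\<close> by (intro nth_equalityI) (auto simp: \<rho>)
    then show "\<exists>r. \<rho> = r # map (\<lambda>x. 2 * L * P * x\<^sup>2) h"
      using \<rho> by blast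
  qed (use that in \<open>auto simp: nth_Cons'\<close>)
  show ?thesis
  proof
    assume A: ?A
    then have len: "length h = n" "length \<rho> = n + 1"
      by (auto simp: aleph_n_def)
    then have ne: "h \<noteq> []" "\<rho> \<noteq> []"
      using assms by auto
    show ?B
      using A sums len norms[OF ne(1)] norms[OF ne(2)] ratios[OF len(2)] coupling[OF len(1)]
      by (auto simp: aleph_n_def)
  next
    assume B: ?B
    then have len: "length h = n" "length \<rho> = n + 1"
      by auto
    then have ne: "h \<noteq> []" "\<rho> \<noteq> []"
      using assms by auto
    have "(\<forall>j\<in>{1..n}. \<rho> ! j = 2 * L * P * (h ! (j - 1))\<^sup>2)"
      using B coupling[OF len(1)] by blast
    moreover have "(\<forall>x\<in>set h. 0 < x) \<and> max_norm h \<le> 1 / (4 * L)"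
      "(\<forall>x\<in>set \<rho>. 0 < x) \<and> max_norm \<rho> \<le> P / (8 * L)"
      using B norms[OF ne(1)] norms[OF ne(2)] by blast+
    ultimately show ?A
      unfolding aleph_n_def mem_Collect_eq case_prod_conv
      using B len ratios[OF len(2)] sums[OF len(1)] by simp
  qed
qed

section \<open>Effect of one subdivision on a discretisation\<close>

lemma set_rho_subdivide:
  assumes "k < length \<rho>"
  shows "set (snd (snd (subdivide (h, t, \<rho>) k))) \<subseteq> insert (\<rho> ! k / 4) (set \<rho>)"
  using assms set_update_subset_insert[of \<rho> 0 "\<rho> ! 0 / 4"] set_take_subset[of k \<rho>]
    set_drop_subset[of "Suc k" \<rho>]
  by auto

text \<open>The loop invariant. Bounds and ratios survive because the only possibly new \<rho>-value
  is a quarter of an old one. The coupling survives because halving an entry \<open>x\<close> of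
  \<open>h\<close> quarters \<open>2 * L * P * x\<^sup>2\<close>, while \<open>k = 0\<close> changes
  only the uncoupled head.\<close>

lemma subdivide_in_aleph_n:
  assumes "n \<ge> 1" and \<delta>: "\<delta> \<in> aleph_n L P T n" and "k \<le> n"
  shows "subdivide \<delta> k \<in> aleph_n L P T (if k > 0 then n + 1 else n)"
proof -
  obtain h t \<rho> where \<delta>_eq: "\<delta> = (h, t, \<rho>)"
    by (cases \<delta>)
  obtain h' t' \<rho>' where sub: "subdivide (h, t, \<rho>) k = (h', t', \<rho>')"
    by (cases "subdivide (h, t, \<rho>) k")
  note old = \<delta>[unfolded \<delta>_eq aleph_n_iff[OF assms(1)]]
  then obtain r where r: "\<rho> = r # map (\<lambda>x. 2 * L * P * x\<^sup>2) h"
    by blast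
  have len: "length h = n" "length t = n + 1" "length \<rho> = n + 1"
    using old r by auto
  have k: "\<rho> ! k \<in> set \<rho>"
    using len \<open>k \<le> n\<close> by simp
  have sub\<rho>: "set \<rho>' \<subseteq> insert (\<rho> ! k / 4) (set \<rho>)"
    using set_rho_subdivide[of k \<rho> h t] sub len \<open>k \<le> n\<close> by simp
  have bounds: "\<forall>x\<in>set \<rho>'. 0 < x \<and> x \<le> P / (8 * L)"
  proof -
    have "0 < \<rho> ! k" "\<rho> ! k \<le> P / (8 * L)"
      using old k by blast+
    then have "0 < \<rho> ! k / 4" "\<rho> ! k / 4 \<le> P / (8 * L)"
      by linarith+
    then show ?thesis
      using sub\<rho> old by blast
  qed
  have ratios: "\<forall>x\<in>set \<rho>'. \<forall>y\<in>set \<rho>'. \<exists>l::int. x / y = 4 powi l"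
  proof (intro ballI)
    fix x y assume xy: "x \<in> set \<rho>'" "y \<in> set \<rho>'"
    \<comment> \<open>Each new entry is an old one times \<open>4 powi l\<close> with
      \<open>l\<close> equal to 0 or -1, so ratios of new entries are ratios of old ones times a
      power of 4.\<close>
    have rep: "\<exists>z\<in>set \<rho>. \<exists>l::int. u = z * 4 powi l" if "u \<in> set \<rho>'" for u
    proof (cases "u \<in> set \<rho>")
      case True
      then show ?thesis by (intro bexI[of _ u] exI[of _ 0]) auto
    next
      case False
      then show ?thesis
        using that sub\<rho> k by (intro bexI[of _ "\<rho> ! k"] exI[of _ "-1"]) auto
    qed
    obtain x' y' and l m :: int
      where x': "x' \<in> set \<rho>" "x = x' * 4 powi l" and y': "y' \<in> set \<rho>" "y = y' * 4 powi m"
      using rep xy by blast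
    obtain q :: int where q: "x' / y' = 4 powi q"
      using x' y' old by blast
    have "x / y = (x' / y') * (4 powi l / 4 powi m)"
      by (simp add: x' y')
    also have "\<dots> = 4 powi (q + l - m)"
      unfolding q by (simp add: power_int_add power_int_diff)
    finally show "\<exists>l::int. x / y = 4 powi l" by blast
  qed
  show ?thesis
  proof (cases k)
    case 0
    then have eqs: "h' = h" "t' = t" and \<rho>': "\<rho>' = r / 4 # map (\<lambda>x. 2 * L * P * x\<^sup>2) h"
      using sub r by auto
    have "(h', t', \<rho>') \<in> aleph_n L P T n"
      unfolding aleph_n_iff[OF assms(1)] eqs using old bounds ratios \<rho>' by blast
    then have "subdivide \<delta> k \<in> aleph_n L P T n"
      by (simp only: \<delta>_eq sub)
    then show ?thesis
      using 0 by simp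
  next
    case (Suc i)
    then have i: "i < n" using \<open>k \<le> n\<close> by simp
    \<comment> \<open>With \<open>k = Suc i\<close>, the interval length to be halved is
      \<open>h ! i\<close>; \<open>a\<close> and \<open>c\<close> are the parts of \<open>h\<close>
      to its left and right.\<close>
    define a x c where "a = take i h" and "x = h ! i" and "c = drop (Suc i) h"
    have h: "h = a @ x # c" and la: "length a = i"
      using i len id_take_nth_drop[of i h] by (auto simp: a_def x_def c_def)
    have n: "n = Suc (i + length c)"
      using h la len by auto
    have h': "h' = a @ [x / 2, x / 2] @ c"
      using sub Suc by (auto simp: a_def x_def c_def)
    have t': "t' = take (Suc i) t @ [t ! Suc i - x / 2] @ drop (Suc i) t"
      using sub Suc by (auto simp: x_def)
    have \<rho>': "\<rho>' = r # map (\<lambda>x. 2 * L * P * x\<^sup>2) h'"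
      using sub Suc la by (auto simp: r h h' nth_append power_divide)
    have told: "t ! j = sum_list (take j h)" if "j \<le> n" for j
      using old that by blast
    have sums: "t' ! j = sum_list (take j h')" if j: "j \<le> Suc n" for j
    proof -
      \<comment> \<open>Nodes up to \<open>i\<close> are unchanged; node \<open>Suc i\<close> is the
        new midpoint, where the prefix sum has gained only \<open>x / 2\<close>; all later nodes are
        old ones shifted by one place, as the two halves add up to \<open>x\<close>.\<close>
      consider "j \<le> i" | "j = Suc i" | m where "j = Suc (Suc (i + m))"
        by (metis add_Suc_right add_Suc_shift le_Suc_ex not_less_eq_eq le_antisym)
      then show ?thesis
      proof cases
        case 1
        then show ?thesis
          using told[of j] i len by (simp add: t' h' h la nth_append)
      next
        case 2
        then show ?thesis
          using told[of "Suc i"] i len by (simp add: t' h' h la nth_append)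
      next
        case 3
        then have "t' ! j = t ! Suc (i + m)"
          using j n len by (simp add: t' nth_append)
        then show ?thesis
          using told[of "Suc (i + m)"] j n by (simp add: 3 h' h la)
      qed
    qed
    have top: "t' ! Suc n = T"
      using old n len by (auto simp: t' nth_append)
    have pos: "\<forall>y\<in>set h'. 0 < y \<and> y \<le> 1 / (4 * L)"
    proof -
      have "0 < x" "x \<le> 1 / (4 * L)"
        using old h by auto
      then have "0 < x / 2" "x / 2 \<le> 1 / (4 * L)"
        by auto
      then show ?thesis
        using old by (auto simp: h h')
    qed
    have "length h' = Suc n" "length t' = Suc n + 1"
      using n la len by (auto simp: h' t')
    then have "(h', t', \<rho>') \<in> aleph_n L P T (Suc n)"
      using sums top pos bounds ratios \<rho>' aleph_n_iff[of "Suc n" h' t' \<rho>' L P T] by simp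
    then have "subdivide \<delta> k \<in> aleph_n L P T (Suc n)"
      by (simp only: \<delta>_eq sub)
    then show ?thesis
      using Suc by simp
  qed
qed

text \<open>Some entry is smaller than \<open>\<rho> ! k\<close>, and their quotient is a power of 4
  above 1, hence at least 4. So even a quarter of \<open>\<rho> ! k\<close> is no smaller than that
  entry. Stating this for any lower bound \<open>b\<close> lets one fixed \<open>b\<close> be
  carried along an execution.\<close>

lemma subdivide_non_min_lower_bound:
  assumes "n \<ge> 1" and \<delta>: "(h, t, \<rho>) \<in> aleph_n L P T n" and k: "k \<le> n"
    and nonmin: "\<not> is_arg_min (\<lambda>i. \<rho> ! i) (\<lambda>i. i \<in> {0..n}) k"
    and b: "\<forall>x\<in>set \<rho>. b \<le> x"
  shows "\<forall>x\<in>set (snd (snd (subdivide (h, t, \<rho>) k))). b \<le> x"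
proof -
  note facts = \<delta>[unfolded aleph_n_iff[OF assms(1)]]
  then have len: "length \<rho> = n + 1"
    by auto
  obtain i where i: "i \<le> n" "\<rho> ! i < \<rho> ! k"
    using nonmin k by (auto simp: is_arg_min_def)
  have mem: "\<rho> ! i \<in> set \<rho>" "\<rho> ! k \<in> set \<rho>"
    using len i k by auto
  then obtain l :: int where l: "\<rho> ! k / \<rho> ! i = 4 powi l"
    using facts by blast
  have pos: "0 < \<rho> ! i"
    using facts mem by blast
  then have "1 < (4::real) powi l"
    using i by (simp flip: l)
  then have "l \<ge> 1"
    using power_int_le_one[of "4::real" l] power_int_increasing[of l 0 "4::real"]
    by (cases "l \<le> 0") auto
  then have "(4::real) \<le> 4 powi l"
    using power_int_increasing[of 1 l "4::real"] by simp
  then have "4 * \<rho> ! i \<le> \<rho> ! k"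
    using pos by (simp add: field_simps flip: l)
  moreover have "b \<le> \<rho> ! i"
    using b mem by blast
  ultimately have "b \<le> \<rho> ! k / 4"
    by simp
  then show ?thesis
    using b set_rho_subdivide[of k \<rho> h t] len k by fastforce
qed

section \<open>Executions of the loop\<close>

lemma admissible_index_le:
  assumes "admissible_index C E n \<delta> k"
  shows "k \<le> n"
  using assms by (auto simp: admissible_index_def is_arg_min_def split: if_splits)

text \<open>Either branch minimises over the finite nonempty set \<open>{0..n}\<close>; hence no
  execution gets stuck.\<close>

lemma admissible_index_exists: "\<exists>k. admissible_index C E n \<delta> k"
proof -
  have "\<exists>k. is_arg_min f (\<lambda>j. j \<in> {0..n}) k" for f :: "nat \<Rightarrow> real"
    using ex_is_arg_min_if_finite[of "{0..n}" f] by simp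
  then show ?thesis
    unfolding admissible_index_def by (cases "Min (increment C \<delta> ` {0..n}) > 0") (simp_all only: if_True if_False)
qed

lemma iteration_aleph_n:
  assumes "iteration C E \<epsilon> (n, \<delta>) (n', \<delta>')" and "n \<ge> 1" and "\<delta> \<in> aleph_n L P T n"
  shows "n' \<ge> 1 \<and> \<delta>' \<in> aleph_n L P T n'"
proof -
  obtain k where "admissible_index C E n \<delta> k" "\<delta>' = subdivide \<delta> k" "n' = (if k > 0 then n + 1 else n)"
    using assms(1) by (auto simp: iteration_def)
  then show ?thesis
    using subdivide_in_aleph_n[OF assms(2,3) admissible_index_le] \<open>n \<ge> 1\<close> by simp
qed

lemma reachable_aleph_n:
  assumes "(iteration C E \<epsilon> ^^ m) (n\<^sub>0, \<delta>\<^sub>0) (n, \<delta>)" and "n\<^sub>0 \<ge> 1" and "\<delta>\<^sub>0 \<in> aleph_n L P T n\<^sub>0"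
  shows "n \<ge> 1 \<and> \<delta> \<in> aleph_n L P T n"
  using assms(1)
proof (induction m arbitrary: n \<delta>)
  case 0
  then show ?case using assms by simp
next
  case (Suc m)
  then obtain n' \<delta>' where "(iteration C E \<epsilon> ^^ m) (n\<^sub>0, \<delta>\<^sub>0) (n', \<delta>')" "iteration C E \<epsilon> (n', \<delta>') (n, \<delta>)"
    by auto
  then show ?case
    using Suc.IH iteration_aleph_n by blast
qed

text \<open>The limit argument in isolation. \<open>C\<close> enters only through
  \<open>admissible_index\<close>; what (P1) to (P4) give for steps at a minimising index is
  packaged in \<open>dec_min\<close> with a uniform constant \<open>c\<close>.\<close>

lemma no_infinite_execution:
  fixes E C :: "discretisation \<Rightarrow> real" and \<omega> :: "real \<Rightarrow> real" and c :: real
  assumes E_pos: "\<And>n \<delta>. n \<ge> 1 \<Longrightarrow> \<delta> \<in> aleph_n L P T n \<Longrightarrow> 0 < E \<delta>"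
    and \<omega>: "strict_mono_on {0..} \<omega>" "\<omega> 0 = 0"
    and dec: "\<And>n h t \<rho> j. n \<ge> 1 \<Longrightarrow> (h, t, \<rho>) \<in> aleph_n L P T n \<Longrightarrow> j \<le> n \<Longrightarrow>
      increment E (h, t, \<rho>) j \<le> - \<omega> (\<rho> ! j)"
    and "c > 0"
    and dec_min: "\<And>n h t \<rho> k. n \<ge> 1 \<Longrightarrow> (h, t, \<rho>) \<in> aleph_n L P T n \<Longrightarrow> E (h, t, \<rho>) > \<epsilon> \<Longrightarrow>
      admissible_index C E n (h, t, \<rho>) k \<Longrightarrow> is_arg_min (\<lambda>i. \<rho> ! i) (\<lambda>i. i \<in> {0..n}) k \<Longrightarrow>
      increment E (h, t, \<rho>) k \<le> - c"
    and start: "n\<^sub>0 \<ge> 1" "\<delta>\<^sub>0 \<in> aleph_n L P T n\<^sub>0"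
    and run: "\<sigma> 0 = (n\<^sub>0, \<delta>\<^sub>0)" "\<And>m. iteration C E \<epsilon> (\<sigma> m) (\<sigma> (Suc m))"
  shows False
proof -
  define n where "n m = fst (\<sigma> m)" for m
  define h where "h m = fst (snd (\<sigma> m))" for m
  define t where "t m = fst (snd (snd (\<sigma> m)))" for m
  define \<rho> where "\<rho> m = snd (snd (snd (\<sigma> m)))" for m
  define e where "e m = E (h m, t m, \<rho> m)" for m
  have \<sigma>: "\<sigma> m = (n m, h m, t m, \<rho> m)" for m
    by (simp add: n_def h_def t_def \<rho>_def)
  have mem: "n m \<ge> 1 \<and> (h m, t m, \<rho> m) \<in> aleph_n L P T (n m)" for m
  proof (induction m)
    case 0
    then show ?case using start run(1) by (simp add: \<sigma>)
  next
    case (Suc m)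
    then show ?case using run(2)[of m] iteration_aleph_n unfolding \<sigma> by blast
  qed
  have "\<exists>k. admissible_index C E (n m) (h m, t m, \<rho> m) k \<and>
      (h (Suc m), t (Suc m), \<rho> (Suc m)) = subdivide (h m, t m, \<rho> m) k" for m
    using run(2)[of m] by (auto simp: iteration_def \<sigma> simp del: subdivide.simps)
  then obtain k where adm: "admissible_index C E (n m) (h m, t m, \<rho> m) (k m)"
    and step: "(h (Suc m), t (Suc m), \<rho> (Suc m)) = subdivide (h m, t m, \<rho> m) (k m)" for m
    by metis
  have k_le: "k m \<le> n m" for m
    using adm admissible_index_le by blast
  have large: "e m > \<epsilon>" for m
    using run(2)[of m] by (simp add: iteration_def \<sigma> e_def)
  have incr: "increment E (h m, t m, \<rho> m) (k m) = e (Suc m) - e m" for m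
    by (simp add: increment_def e_def step del: subdivide.simps)
  have len: "length (\<rho> m) = n m + 1" and \<rho>_pos: "\<forall>x\<in>set (\<rho> m). 0 < x" for m
    using mem[of m] by (auto simp: aleph_n_def)
  have drop_\<omega>: "\<omega> (\<rho> m ! k m) \<le> e m - e (Suc m)" for m
    using dec[of "n m" "h m" "t m" "\<rho> m" "k m"] mem k_le incr by fastforce
  have selected: "\<rho> m ! k m \<in> set (\<rho> m)" for m
    using len[of m] k_le[of m] by simp
  have \<omega>_pos: "0 < \<omega> x" if "0 < x" for x
    using strict_mono_onD[OF \<omega>(1), of 0 x] \<omega>(2) that by simp
  have "e (Suc m) \<le> e m" for m
    using drop_\<omega>[of m] \<omega>_pos[of "\<rho> m ! k m"] selected[of m] \<rho>_pos[of m] by fastforce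
  then have "decseq e"
    by (rule decseq_SucI)
  moreover have "0 \<le> e m" for m
    using E_pos mem[of m] unfolding e_def by fastforce
  ultimately obtain l where "e \<longlonglongrightarrow> l"
    using decseq_convergent[of e 0] by blast
  then have lim: "(\<lambda>m. e m - e (Suc m)) \<longlonglongrightarrow> 0"
    using tendsto_diff[OF _ LIMSEQ_Suc] by fastforce
  \<comment> \<open>From \<open>M\<close> on, each step lowers \<open>E\<close> by less than
    \<open>c\<close>, which by \<open>dec_min\<close> rules out minimising indices.\<close>
  then obtain M where M: "e m - e (Suc m) < c" if "m \<ge> M" for m
    using order_tendstoD(2)[OF lim \<open>c > 0\<close>] by (auto simp: eventually_sequentially)
  have nonmin: "\<not> is_arg_min (\<lambda>i. \<rho> m ! i) (\<lambda>i. i \<in> {0..n m}) (k m)" if "m \<ge> M" for m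
    using dec_min[of "n m" "h m" "t m" "\<rho> m" "k m"] mem[of m] adm[of m] large[of m] M[OF that]
      incr[of m] by (auto simp: e_def)
  \<comment> \<open>The minimum is frozen at time \<open>M\<close>; it is positive and remains a
    lower bound for all later \<rho>.\<close>
  define b where "b = Min (set (\<rho> M))"
  have ne: "set (\<rho> M) \<noteq> {}"
    using selected[of M] by auto
  have "b > 0"
    using \<rho>_pos ne by (simp add: b_def)
  have lower: "\<forall>x\<in>set (\<rho> m). b \<le> x" if "m \<ge> M" for m
    using that
  proof (induction m rule: dec_induct)
    case base
    then show ?case by (simp add: b_def)
  next
    case (step m)
    then show ?case
      using subdivide_non_min_lower_bound[of "n m" "h m" "t m" "\<rho> m" L P T "k m" b]
        mem[of m] k_le nonmin \<open>(h (Suc m), t (Suc m), \<rho> (Suc m)) = _\<close>[symmetric]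
      by (simp del: subdivide.simps)
  qed
  have "\<omega> b \<le> e m - e (Suc m)" if "m \<ge> M" for m
  proof -
    have "b \<le> \<rho> m ! k m"
      using lower[OF that] selected by blast
    then have "\<omega> b \<le> \<omega> (\<rho> m ! k m)"
      using strict_mono_on_leD[OF \<omega>(1)] \<open>b > 0\<close> by simp
    then show ?thesis
      using drop_\<omega>[of m] by simp
  qed
  then have "\<forall>\<^sub>F m in sequentially. \<omega> b \<le> e m - e (Suc m)"
    by (auto simp: eventually_sequentially)
  \<comment> \<open>The decrements tend to 0 yet eventually are at least \<open>\<omega> b\<close>,
    whereas \<open>b > 0\<close> gives \<open>\<omega> b > \<omega> 0 = 0\<close>.\<close>
  then have "\<omega> b \<le> 0"
    using tendsto_lowerbound[OF lim] by simp
  then show False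
    using \<omega>_pos[OF \<open>b > 0\<close>] by simp
qed

text \<open>Since \<open>k\<close> has a positive cost increment, it was selected by the quotient
  rule. Comparing with \<open>j\<close>, the quotient at \<open>k\<close> is at most
  \<open>- w / (W * g k)\<close>, with \<open>g\<close> the increment of \<open>C\<close>;
  multiplying by \<open>g k\<close> cancels the unknown cost.\<close>

lemma admissible_min_index_decrement:
  assumes adm: "admissible_index C E n (h, t, \<rho>) k" and "j \<le> n"
    and Ej: "increment E (h, t, \<rho>) j \<le> - w" and "0 < w"
    and Ck: "increment C (h, t, \<rho>) k > 0"
    and Cj: "increment C (h, t, \<rho>) j \<le> W * increment C (h, t, \<rho>) k" and "0 < W"
  shows "increment E (h, t, \<rho>) k \<le> - (w / W)"
proof -
  define f where "f i = increment E (h, t, \<rho>) i" for i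
  define g where "g i = increment C (h, t, \<rho>) i" for i
  have k: "k \<le> n"
    using adm by (rule admissible_index_le)
  have min_pos: "Min (g ` {0..n}) > 0"
  proof (rule ccontr)
    \<comment> \<open>In the other branch \<open>k\<close> minimises \<open>g\<close>, so
      \<open>g k\<close> would be at most a nonpositive minimum.\<close>
    assume neg: "\<not> ?thesis"
    then have "is_arg_min g (\<lambda>j. j \<in> {0..n}) k"
      using adm by (simp add: admissible_index_def g_def[abs_def] del: Min_gr_iff atLeastAtMost_iff)
    then have "\<forall>i\<in>{0..n}. g k \<le> g i"
      by (auto simp: is_arg_min_linorder)
    then have "g k \<le> Min (g ` {0..n})"
      by simp
    moreover have "0 < g k"
      using Ck by (simp add: g_def)
    ultimately show False
      using neg by linarith
  qed
  then have "g j > 0"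
    using \<open>j \<le> n\<close> by simp
  have "is_arg_min (\<lambda>i. f i / g i) (\<lambda>i. i \<in> {0..n}) k"
    using adm min_pos by (simp add: admissible_index_def f_def[abs_def] g_def[abs_def])
  then have "f k / g k \<le> f j / g j"
    using \<open>j \<le> n\<close> by (auto simp: is_arg_min_linorder)
  also have "\<dots> \<le> - w / g j"
    using Ej \<open>g j > 0\<close> by (intro divide_right_mono) (auto simp: f_def)
  \<comment> \<open>The numerator is negative, so enlarging the positive denominator increases the
    quotient.\<close>
  also have "\<dots> \<le> - w / (W * g k)"
    using Cj \<open>g j > 0\<close> \<open>0 < w\<close> Ck by (auto intro!: divide_left_mono mult_pos_pos simp: g_def \<open>0 < W\<close>)
  finally have "f k \<le> - w / (W * g k) * g k"
    using Ck by (simp add: g_def pos_divide_le_eq)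
  then show ?thesis
    using Ck by (simp add: f_def g_def)
qed

text \<open>If nothing is ever returned, every reachable state satisfies the guard and so has a
  successor; dependent choice then yields an infinite execution.\<close>

lemma algorithm_returns_if_terminates:
  assumes "algorithm_terminates C E \<epsilon> s"
  shows "\<exists>m n \<delta>. algorithm_returns C E \<epsilon> s m (n, \<delta>)"
proof (rule ccontr)
  assume none: "\<not> ?thesis"
  \<comment> \<open>Reachability is carried along in the choice, since successors are only known for
    reachable states; the clause for \<open>m = 0\<close> records the start.\<close>
  have "\<exists>\<sigma>. \<forall>m. ((iteration C E \<epsilon> ^^ m) s (\<sigma> m) \<and> (m = 0 \<longrightarrow> \<sigma> m = s)) \<and>
      iteration C E \<epsilon> (\<sigma> m) (\<sigma> (Suc m))"
  proof (rule dependent_nat_choice)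
    show "\<exists>x. (iteration C E \<epsilon> ^^ 0) s x \<and> ((0::nat) = 0 \<longrightarrow> x = s)"
      by auto
  next
    fix x m
    assume x: "(iteration C E \<epsilon> ^^ m) s x \<and> (m = 0 \<longrightarrow> x = s)"
    obtain n \<delta> where "x = (n, \<delta>)" by (cases x)
    moreover from this have "E \<delta> > \<epsilon>"
      using none x unfolding algorithm_returns_def by blast
    ultimately obtain y where y: "iteration C E \<epsilon> x y"
      using assms x unfolding algorithm_terminates_def by blast
    then have "(iteration C E \<epsilon> ^^ Suc m) s y"
      using x by (blast intro: relpowp_Suc_I)
    then show "\<exists>y. ((iteration C E \<epsilon> ^^ Suc m) s y \<and> (Suc m = 0 \<longrightarrow> y = s)) \<and> iteration C E \<epsilon> x y"
      using y by blast
  qed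
  then obtain \<sigma> where "\<sigma> 0 = s" "\<forall>m. iteration C E \<epsilon> (\<sigma> m) (\<sigma> (Suc m))"
    by blast
  then show False
    using assms unfolding algorithm_terminates_def by blast
qed

section \<open>Uniform constants from (P1) to (P4), and the conclusion\<close>

theorem theorem5p7:
  fixes L P T :: real
    and C E :: "discretisation \<Rightarrow> real"
    and n\<^sub>0 :: nat and \<delta>\<^sub>0 :: discretisation and \<epsilon> :: real
  assumes "L > 0" and "P > 0" and "T > 0"
    and "\<forall>\<delta>\<in>aleph L P T. C \<delta> > 0"
    and "\<forall>\<delta>\<in>aleph L P T. E \<delta> > 0"
    and P1: "\<exists>\<omega>\<^sub>1 :: real \<Rightarrow> real.
      continuous_on {0<..} \<omega>\<^sub>1 \<and> (\<forall>s>0. \<omega>\<^sub>1 s > 0) \<and> (\<omega>\<^sub>1 \<longlongrightarrow> 0) (at_right 0) \<and>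
      (\<forall>n\<ge>1. \<forall>(h, t, \<rho>)\<in>aleph_n L P T n. E (h, t, \<rho>) \<le> \<omega>\<^sub>1 (max_norm \<rho>))"
    and P2: "\<exists>\<omega>\<^sub>2 :: real \<Rightarrow> real.
      strict_mono_on {0..} \<omega>\<^sub>2 \<and> continuous_on {0..} \<omega>\<^sub>2 \<and> (\<forall>s\<ge>0. \<omega>\<^sub>2 s \<ge> 0) \<and> \<omega>\<^sub>2 0 = 0 \<and>
      (\<forall>n\<ge>1. \<forall>(h, t, \<rho>)\<in>aleph_n L P T n. \<forall>j\<in>{0..n}.
         increment E (h, t, \<rho>) j \<le> - \<omega>\<^sub>2 (\<rho> ! j))"
    and P3: "\<forall>n\<ge>1. \<forall>(h, t, \<rho>)\<in>aleph_n L P T n. \<forall>k.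
      is_arg_min (\<lambda>i. \<rho> ! i) (\<lambda>i. i \<in> {0..n}) k \<longrightarrow> increment C (h, t, \<rho>) k > 0"
    and P4: "\<exists>\<omega>\<^sub>4 :: real \<Rightarrow> real.
      continuous_on {0<..} \<omega>\<^sub>4 \<and> (\<forall>s>0. \<omega>\<^sub>4 s > 0) \<and>
      (\<forall>n\<ge>1. \<forall>(h, t, \<rho>)\<in>aleph_n L P T n. \<forall>j\<in>{0..n}. \<forall>k.
         is_arg_min (\<lambda>i. \<rho> ! i) (\<lambda>i. i \<in> {0..n}) k \<longrightarrow>
         increment C (h, t, \<rho>) j \<le> \<omega>\<^sub>4 (\<rho> ! j) * increment C (h, t, \<rho>) k)"
    and "n\<^sub>0 \<ge> 1" and "\<delta>\<^sub>0 \<in> aleph_n L P T n\<^sub>0" and "\<epsilon> > 0"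
  shows "algorithm_terminates C E \<epsilon> (n\<^sub>0, \<delta>\<^sub>0)
    \<and> (\<exists>m n \<delta>. algorithm_returns C E \<epsilon> (n\<^sub>0, \<delta>\<^sub>0) m (n, \<delta>))
    \<and> (\<forall>m n \<delta>. algorithm_returns C E \<epsilon> (n\<^sub>0, \<delta>\<^sub>0) m (n, \<delta>) \<longrightarrow>
          \<delta> \<in> aleph_n L P T n \<and> E \<delta> \<le> \<epsilon>)"
proof -
  obtain \<omega>\<^sub>1 where w1: "(\<omega>\<^sub>1 \<longlongrightarrow> 0) (at_right 0)"
    "\<And>n h t \<rho>. n \<ge> 1 \<Longrightarrow> (h, t, \<rho>) \<in> aleph_n L P T n \<Longrightarrow> E (h, t, \<rho>) \<le> \<omega>\<^sub>1 (max_norm \<rho>)"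
    using P1 by fastforce
  obtain \<omega>\<^sub>2 where w2: "strict_mono_on {0..} \<omega>\<^sub>2" "\<omega>\<^sub>2 0 = 0"
    "\<And>n h t \<rho> j. n \<ge> 1 \<Longrightarrow> (h, t, \<rho>) \<in> aleph_n L P T n \<Longrightarrow> j \<le> n \<Longrightarrow>
      increment E (h, t, \<rho>) j \<le> - \<omega>\<^sub>2 (\<rho> ! j)"
    using P2 by fastforce
  have p3: "\<And>n h t \<rho> k. n \<ge> 1 \<Longrightarrow> (h, t, \<rho>) \<in> aleph_n L P T n \<Longrightarrow>
      is_arg_min (\<lambda>i. \<rho> ! i) (\<lambda>i. i \<in> {0..n}) k \<Longrightarrow> increment C (h, t, \<rho>) k > 0"
    using P3 by fastforce
  obtain \<omega>\<^sub>4 where w4: "continuous_on {0<..} \<omega>\<^sub>4"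
    "\<And>n h t \<rho> j k. n \<ge> 1 \<Longrightarrow> (h, t, \<rho>) \<in> aleph_n L P T n \<Longrightarrow> j \<le> n \<Longrightarrow>
      is_arg_min (\<lambda>i. \<rho> ! i) (\<lambda>i. i \<in> {0..n}) k \<Longrightarrow>
      increment C (h, t, \<rho>) j \<le> \<omega>\<^sub>4 (\<rho> ! j) * increment C (h, t, \<rho>) k"
    using P4 by fastforce
  \<comment> \<open>While \<open>E\<close> exceeds \<epsilon>, (P1) then forces the largest entry of
    \<rho> to be at least \<open>s\<close>.\<close>
  obtain s where s: "s > 0" "\<And>x. 0 < x \<Longrightarrow> x < s \<Longrightarrow> \<omega>\<^sub>1 x < \<epsilon>"
    using order_tendstoD(2)[OF w1(1) \<open>\<epsilon> > 0\<close>] by (auto simp: eventually_at_right_field)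
  \<comment> \<open>The largest entry of \<rho> thus lies in a fixed compact interval, on which the
    continuous \<open>\<omega>\<^sub>4\<close> is bounded. Should the interval be empty, any bound
    will do.\<close>
  have "continuous_on {s..P / (8 * L)} \<omega>\<^sub>4"
    using s(1) by (intro continuous_on_subset[OF w4(1)]) auto
  then have "\<exists>V. \<forall>x\<in>{s..P / (8 * L)}. \<omega>\<^sub>4 x \<le> V"
    using continuous_attains_sup[of "{s..P / (8 * L)}" \<omega>\<^sub>4] by fastforce
  then obtain V where "\<forall>x\<in>{s..P / (8 * L)}. \<omega>\<^sub>4 x \<le> V" ..
  then obtain W where W: "W > 0" "\<And>x. s \<le> x \<Longrightarrow> x \<le> P / (8 * L) \<Longrightarrow> \<omega>\<^sub>4 x \<le> W"
    \<comment> \<open>The maximum with 1 makes the bound positive, so that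
      \<open>\<omega>\<^sub>2 s / W\<close> is a positive decrement.\<close>
    by (intro that[of "max 1 V"]) (auto simp: le_max_iff_disj)
  have w2s: "0 < \<omega>\<^sub>2 s"
    using strict_mono_onD[OF w2(1), of 0 s] w2(2) s(1) by simp
  have dec_min: "increment E (h, t, \<rho>) k \<le> - (\<omega>\<^sub>2 s / W)"
    if "n \<ge> 1" and \<delta>: "(h, t, \<rho>) \<in> aleph_n L P T n" and large: "E (h, t, \<rho>) > \<epsilon>"
      and adm: "admissible_index C E n (h, t, \<rho>) k"
      and k: "is_arg_min (\<lambda>i. \<rho> ! i) (\<lambda>i. i \<in> {0..n}) k" for n h t \<rho> k
  proof -
    note facts = \<delta>[unfolded aleph_n_iff[OF \<open>n \<ge> 1\<close>]]
    then have len: "length \<rho> = n + 1"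
      by auto
    have mem: "max_norm \<rho> \<in> set \<rho>"
      using facts by (intro max_norm_mem) auto
    \<comment> \<open>The index compared with \<open>k\<close> is that of a largest entry: both
      \<open>\<omega>\<^sub>2\<close> from below and \<open>\<omega>\<^sub>4\<close> from above are
      controlled there.\<close>
    then obtain j where j: "j \<le> n" "\<rho> ! j = max_norm \<rho>"
      using len by (auto simp: in_set_conv_nth less_Suc_eq_le)
    have up: "0 < \<rho> ! j" "\<rho> ! j \<le> P / (8 * L)"
      using facts mem j by auto
    have low: "s \<le> \<rho> ! j"
      using s(2)[of "\<rho> ! j"] w1(2)[OF \<open>n \<ge> 1\<close> \<delta>] up(1) large j(2) by fastforce
    show ?thesis
    proof (rule admissible_min_index_decrement[OF adm j(1) _ w2s _ _ W(1)])
      have "\<omega>\<^sub>2 s \<le> \<omega>\<^sub>2 (\<rho> ! j)"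
        using strict_mono_on_leD[OF w2(1)] s(1) low by simp
      then show "increment E (h, t, \<rho>) j \<le> - \<omega>\<^sub>2 s"
        using w2(3)[OF \<open>n \<ge> 1\<close> \<delta> j(1)] by simp
      show Ck: "increment C (h, t, \<rho>) k > 0"
        using p3[OF \<open>n \<ge> 1\<close> \<delta> k] .
      have "\<omega>\<^sub>4 (\<rho> ! j) * increment C (h, t, \<rho>) k \<le> W * increment C (h, t, \<rho>) k"
        using W(2)[OF low up(2)] Ck by (intro mult_right_mono) auto
      then show "increment C (h, t, \<rho>) j \<le> W * increment C (h, t, \<rho>) k"
        using w4(2)[OF \<open>n \<ge> 1\<close> \<delta> j(1) k] by simp
    qed
  qed
  have E_pos: "\<And>n \<delta>. n \<ge> 1 \<Longrightarrow> \<delta> \<in> aleph_n L P T n \<Longrightarrow> 0 < E \<delta>"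
    using \<open>\<forall>\<delta>\<in>aleph L P T. E \<delta> > 0\<close> by (auto simp: aleph_def)
  \<comment> \<open>Progress holds in every state satisfying the guard, reachable or not.\<close>
  have "\<exists>s'. iteration C E \<epsilon> (n, \<delta>) s'" if "E \<delta> > \<epsilon>" for n \<delta>
  proof -
    obtain k where "admissible_index C E n \<delta> k"
      using admissible_index_exists by blast
    then have "iteration C E \<epsilon> (n, \<delta>) (if k > 0 then n + 1 else n, subdivide \<delta> k)"
      using that by (auto simp: iteration_def)
    then show ?thesis ..
  qed
  moreover have False
    if "\<sigma> 0 = (n\<^sub>0, \<delta>\<^sub>0)" "\<forall>m. iteration C E \<epsilon> (\<sigma> m) (\<sigma> (Suc m))" for \<sigma>
    by (rule no_infinite_execution[where c = "\<omega>\<^sub>2 s / W" and \<omega> = \<omega>\<^sub>2 and \<sigma> = \<sigma>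
          and E = E and C = C and \<epsilon> = \<epsilon> and L = L and P = P and T = T])
      (use E_pos w2 w2s W(1) dec_min \<open>n\<^sub>0 \<ge> 1\<close> \<open>\<delta>\<^sub>0 \<in> aleph_n L P T n\<^sub>0\<close> that in \<open>blast intro: divide_pos_pos\<close>)+
  ultimately have terminates: "algorithm_terminates C E \<epsilon> (n\<^sub>0, \<delta>\<^sub>0)"
    unfolding algorithm_terminates_def by blast
  have "\<delta> \<in> aleph_n L P T n \<and> E \<delta> \<le> \<epsilon>" if "algorithm_returns C E \<epsilon> (n\<^sub>0, \<delta>\<^sub>0) m (n, \<delta>)" for m n \<delta>
    using that reachable_aleph_n \<open>n\<^sub>0 \<ge> 1\<close> \<open>\<delta>\<^sub>0 \<in> aleph_n L P T n\<^sub>0\<close>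
    by (fastforce simp: algorithm_returns_def)
  then show ?thesis
    using terminates algorithm_returns_if_terminates[OF terminates] by blast
qed

end
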